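(* Let $a>0$, $\gamma\in(0,1)$. Let $\mathrm{DtN}_1,\mathrm{DtN}_2$ be the Dirichlet to Neumann operators, $\mathrm{NtD}_j=\mathrm{DtN}_j^{-1}$, and $\mathbb{P}_1,\mathbb{P}_2$ the Calderón projectors for the operator $-\frac{d^2}{dx^2}+a^2$ on $\Omega_1=(0,\gamma)$ and $\Omega_2=(\gamma,1)$ with homogeneous Dirichlet conditions at $0$ and $1$, as defined in the context. Then $$\mathbb{P}_1=\begin{pmatrix}(\mathrm{DtN}_1+\mathrm{DtN}_2)^{-1}\mathrm{DtN}_2&(\mathrm{DtN}_1+\mathrm{DtN}_2)^{-1}\\ (\mathrm{NtD}_1+\mathrm{NtD}_2)^{-1}&(\mathrm{NtD}_1+\mathrm{NtD}_2)^{-1}\mathrm{NtD}_2\end{pmatrix},$$ $$\mathbb{P}_2=\begin{pmatrix}(\mathrm{DtN}_1+\mathrm{DtN}_2)^{-1}\mathrm{DtN}_1&(\mathrm{DtN}_1+\mathrm{DtN}_2)^{-1}\\ (\mathrm{NtD}_1+\mathrm{NtD}_2)^{-1}&(\mathrm{NtD}_1+\mathrm{NtD}_2)^{-1}\mathrm{NtD}_1\end{pmatrix}.$$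
   Context: Dirichlet to Neumann operators: $\mathrm{DtN}_1$ maps $g$ to $u_1'(\gamma)$, where $-u_1''+a^2u_1=0$ on $(0,\gamma)$, $u_1(0)=0$, $u_1(\gamma)=g$; $\mathrm{DtN}_2$ maps $g$ to $-u_2'(\gamma)$, where $-u_2''+a^2u_2=0$ on $(\gamma,1)$, $u_2(1)=0$, $u_2(\gamma)=g$. These are nonzero scalars, and $\mathrm{NtD}_j$ is the inverse of $\mathrm{DtN}_j$. Calderón projectors: let $D=a\left[\cosh(a(1-\gamma))\sinh(a\gamma)+\sinh(a(1-\gamma))\cosh(a\gamma)\right]$ and define $$G_1(\alpha,\beta)(x)=\tfrac1D\left[a\,\alpha\cosh(a(1-\gamma))+\beta\sinh(a(1-\gamma))\right]\sinh(ax),\quad x\in(0,\gamma),$$ $$G_2(\alpha,\beta)(x)=\tfrac1D\left[a\,\alpha\cosh(a\gamma)+\beta\sinh(a\gamma)\right]\sinh(a(1-x)),\quad x\in(\gamma,1),$$ and the traces $T_1(u)=(u(\gamma_-),u'(\gamma_-))^T$, $T_2(u)=(u(\gamma_+),-u'(\gamma_+))^T$. Then $\mathbb{P}_j:=T_j\circ G_j$, a $2\times2$ matrix acting on $(\alpha,\beta)^T$. *)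

theory Defs
  imports "HOL-Analysis.Analysis"
begin

text \<open>Classical solutions of \<open>- u'' + a\<^sup>2 u = 0\<close> on the open interval \<open>(l, r)\<close>, continuous up to the
  end points so that boundary values make sense. Values of \<open>u\<close> outside \<open>[l, r]\<close> are irrelevant.\<close>

definition solves_ode :: "real \<Rightarrow> real \<Rightarrow> real \<Rightarrow> (real \<Rightarrow> real) \<Rightarrow> bool" where
  "solves_ode a l r u \<longleftrightarrow>
     continuous_on {l..r} u \<and>
     (\<exists>u' u''. \<forall>x\<in>{l<..<r}.
        (u has_real_derivative u' x) (at x) \<and>
        (u' has_real_derivative u'' x) (at x) \<and>
        - u'' x + a\<^sup>2 * u x = 0)"

text \<open>The operators \<open>g \<mapsto> u\<^sub>1'(\<gamma>)\<close> and \<open>g \<mapsto> - u\<^sub>2'(\<gamma>)\<close>; the derivative at the end point \<open>\<gamma>\<close> is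
  one-sided, taken from inside the subdomain.\<close>

definition DtN1_op :: "real \<Rightarrow> real \<Rightarrow> real \<Rightarrow> real" where
  "DtN1_op a \<gamma> g = (THE d. \<exists>u. solves_ode a 0 \<gamma> u \<and> u 0 = 0 \<and> u \<gamma> = g \<and>
     (u has_real_derivative d) (at \<gamma> within {0..\<gamma>}))"

definition DtN2_op :: "real \<Rightarrow> real \<Rightarrow> real \<Rightarrow> real" where
  "DtN2_op a \<gamma> g = (THE d. \<exists>u. solves_ode a \<gamma> 1 u \<and> u 1 = 0 \<and> u \<gamma> = g \<and>
     (u has_real_derivative - d) (at \<gamma> within {\<gamma>..1}))"

text \<open>These operators on the one-dimensional space of interface values are multiplications by
  scalars, with which they are identified.\<close>

definition DtN1 :: "real \<Rightarrow> real \<Rightarrow> real" where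
  "DtN1 a \<gamma> = (THE c. \<forall>g. DtN1_op a \<gamma> g = c * g)"

definition DtN2 :: "real \<Rightarrow> real \<Rightarrow> real" where
  "DtN2 a \<gamma> = (THE c. \<forall>g. DtN2_op a \<gamma> g = c * g)"

definition NtD1 :: "real \<Rightarrow> real \<Rightarrow> real" where
  "NtD1 a \<gamma> = inverse (DtN1 a \<gamma>)"

definition NtD2 :: "real \<Rightarrow> real \<Rightarrow> real" where
  "NtD2 a \<gamma> = inverse (DtN2 a \<gamma>)"

definition calderon_D :: "real \<Rightarrow> real \<Rightarrow> real" where
  "calderon_D a \<gamma> =
     a * (cosh (a * (1 - \<gamma>)) * sinh (a * \<gamma>) + sinh (a * (1 - \<gamma>)) * cosh (a * \<gamma>))"

text \<open>A vector \<open>v\<close> carries the data \<open>(\<alpha>, \<beta>)\<close> as \<open>v $ 1 = \<alpha>\<close>, \<open>v $ 2 = \<beta>\<close>. The functions \<open>G1 a \<gamma> v\<close> and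
  \<open>G2 a \<gamma> v\<close> are only meaningful on \<open>(0, \<gamma>)\<close> and \<open>(\<gamma>, 1)\<close>; the one-sided traces below do not see
  other values.\<close>

definition G1 :: "real \<Rightarrow> real \<Rightarrow> real^2 \<Rightarrow> real \<Rightarrow> real" where
  "G1 a \<gamma> v x = 1 / calderon_D a \<gamma> *
     (a * v $ 1 * cosh (a * (1 - \<gamma>)) + v $ 2 * sinh (a * (1 - \<gamma>))) * sinh (a * x)"

definition G2 :: "real \<Rightarrow> real \<Rightarrow> real^2 \<Rightarrow> real \<Rightarrow> real" where
  "G2 a \<gamma> v x = 1 / calderon_D a \<gamma> *
     (a * v $ 1 * cosh (a * \<gamma>) + v $ 2 * sinh (a * \<gamma>)) * sinh (a * (1 - x))"

definition T1 :: "real \<Rightarrow> (real \<Rightarrow> real) \<Rightarrow> real^2" where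
  "T1 \<gamma> u = vector [Lim (at_left \<gamma>) u, Lim (at_left \<gamma>) (deriv u)]"

definition T2 :: "real \<Rightarrow> (real \<Rightarrow> real) \<Rightarrow> real^2" where
  "T2 \<gamma> u = vector [Lim (at_right \<gamma>) u, - Lim (at_right \<gamma>) (deriv u)]"

definition P1 :: "real \<Rightarrow> real \<Rightarrow> real^2 \<Rightarrow> real^2" where
  "P1 a \<gamma> = T1 \<gamma> \<circ> G1 a \<gamma>"

definition P2 :: "real \<Rightarrow> real \<Rightarrow> real^2 \<Rightarrow> real^2" where
  "P2 a \<gamma> = T2 \<gamma> \<circ> G2 a \<gamma>"

end

theory Submission
  imports Defs
begin

text \<open>Solutions of \<open>u'' = a\<^sup>2 u\<close> are determined by their boundary values, so the harmonic extensions
  are multiples of \<open>sinh (a x)\<close> and \<open>sinh (a (1 - x))\<close>. Hence \<open>DtN\<^sub>1 = a coth (a \<gamma>)\<close> and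
  \<open>DtN\<^sub>2 = a coth (a (1 - \<gamma>))\<close>, and both identities reduce to rational expressions in these
  hyperbolic values.\<close>

lemma solves_ode_exp_form:
  fixes a :: real
  assumes "a \<noteq> 0" and "l < r" and "solves_ode a l r u"
  obtains A B where "\<And>x. x \<in> {l..r} \<Longrightarrow> u x = A * exp (a * x) + B * exp (- (a * x))"
proof -
  from assms(3) obtain u' u'' where
    cont: "continuous_on {l..r} u" and
    ode: "\<And>x. x \<in> {l<..<r} \<Longrightarrow> (u has_real_derivative u' x) (at x)"
      "\<And>x. x \<in> {l<..<r} \<Longrightarrow> (u' has_real_derivative u'' x) (at x)"
      "\<And>x. x \<in> {l<..<r} \<Longrightarrow> u'' x = a\<^sup>2 * u x"
    unfolding solves_ode_def by force
  \<comment> \<open>The factors \<open>d/dx \<plusminus> a\<close> of \<open>d\<^sup>2/dx\<^sup>2 - a\<^sup>2\<close> yield two first integrals.\<close>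
  have first_integral: "\<exists>C. \<forall>x\<in>{l<..<r}. exp (- (s * x)) * (u' x + s * u x) = C"
    if s: "s\<^sup>2 = a\<^sup>2" for s
  proof -
    have "((\<lambda>x. exp (- (s * x)) * (u' x + s * u x)) has_real_derivative 0) (at x within {l<..<r})"
      if x: "x \<in> {l<..<r}" for x
    proof -
      have "((\<lambda>x. exp (- (s * x)) * (u' x + s * u x)) has_real_derivative
          exp (- (s * x)) * (u'' x + s * u' x) + - s * exp (- (s * x)) * (u' x + s * u x)) (at x)"
        by (auto intro!: derivative_eq_intros ode(1,2)[OF x])
      \<comment> \<open>The terms in \<open>s * u' x\<close> cancel, leaving a multiple of
        \<open>u'' x - s\<^sup>2 * u x\<close>, which vanishes because
        \<open>s\<^sup>2 = a\<^sup>2\<close>.\<close>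
      moreover have "exp (- (s * x)) * (u'' x + s * u' x)
          + - s * exp (- (s * x)) * (u' x + s * u x) = 0"
        using ode(3)[OF x] by (simp flip: s) (simp add: algebra_simps power2_eq_square)
      ultimately show ?thesis
        by (metis has_field_derivative_at_within)
    qed
    then show ?thesis
      by (intro has_field_derivative_zero_constant) auto
  qed
  obtain P where P: "\<And>x. x \<in> {l<..<r} \<Longrightarrow> exp (- (a * x)) * (u' x + a * u x) = P"
    using first_integral[of a] by auto
  obtain Q where Q: "\<And>x. x \<in> {l<..<r} \<Longrightarrow> exp (a * x) * (u' x - a * u x) = Q"
    using first_integral[of "- a"] by auto
  \<comment> \<open>Subtracting the first integrals eliminates \<open>u'\<close> and leaves
    \<open>2 * a * u x\<close> as a combination of the two exponentials; \<open>A\<close> and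
    \<open>B\<close> are its coefficients after division by \<open>2 * a\<close>.\<close>
  define A B where "A = P / (2 * a)" and "B = - Q / (2 * a)"
  have interior: "u x - (A * exp (a * x) + B * exp (- (a * x))) = 0" if "x \<in> {l<..<r}" for x
  proof -
    have "u' x + a * u x = P * exp (a * x)" and "u' x - a * u x = Q * exp (- (a * x))"
      by (simp_all add: exp_minus flip: P[OF that] Q[OF that])
    then have "2 * a * u x = P * exp (a * x) - Q * exp (- (a * x))"
      by linarith
    then show ?thesis
      using \<open>a \<noteq> 0\<close> by (simp add: A_def B_def divide_simps) (simp add: mult_ac)
  qed
  \<comment> \<open>The equation is only available in the open interval; continuity of
    \<open>u\<close> carries the formula to the end points, where the boundary values are read
    off.\<close>
  have "continuous_on (closure {l<..<r}) (\<lambda>x. u x - (A * exp (a * x) + B * exp (- (a * x))))"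
    using cont \<open>l < r\<close> by (auto intro!: continuous_intros)
  then have "u x - (A * exp (a * x) + B * exp (- (a * x))) = 0" if "x \<in> {l..r}" for x
    by (rule continuous_constant_on_closure[OF _ interior]) (use that \<open>l < r\<close> in simp_all)
  then show thesis
    by (intro that[of A B]) (simp only: right_minus_eq)
qed

text \<open>Eliminates the unknown coefficients of the exponential form in favour of the boundary
  values: inserting that form at \<open>x\<close>, \<open>l\<close> and \<open>r\<close> leaves an
  identity between exponentials. This is uniqueness for the Dirichlet problem in explicit
  form.\<close>

lemma solves_ode_boundary_form:
  fixes a :: real
  assumes "a \<noteq> 0" and "l < r" and "solves_ode a l r u" and x: "x \<in> {l..r}"
  shows "u x = (u l * sinh (a * (r - x)) + u r * sinh (a * (x - l))) / sinh (a * (r - l))"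
proof -
  obtain A B where AB: "\<And>x. x \<in> {l..r} \<Longrightarrow> u x = A * exp (a * x) + B * exp (- (a * x))"
    using solves_ode_exp_form[OF assms(1-3)] by blast
  have "u x * sinh (a * (r - l)) = u l * sinh (a * (r - x)) + u r * sinh (a * (x - l))"
    using x \<open>l < r\<close>
    by (simp add: AB sinh_field_def right_diff_distrib exp_diff exp_minus field_simps)
  moreover have "sinh (a * (r - l)) \<noteq> 0"
    using assms(1,2) by simp
  ultimately show ?thesis
    by (simp add: field_simps)
qed

text \<open>The shift \<open>b\<close> is the outer boundary point, so one formula serves both
  subdomains, with \<open>b = 0\<close> and \<open>b = 1\<close>.\<close>

lemma has_real_derivative_sinh_affine:
  "((\<lambda>x. C * sinh (a * (x - b))) has_real_derivative C * (a * cosh (a * (x - b)))) (at x within S)"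
  by (auto intro!: derivative_eq_intros)

lemma solves_ode_sinh: "solves_ode a l r (\<lambda>x. C * sinh (a * (x - b)))"
  unfolding solves_ode_def
  by (intro conjI exI[of _ "\<lambda>x. C * a * cosh (a * (x - b))"]
      exI[of _ "\<lambda>x. C * a\<^sup>2 * sinh (a * (x - b))"])
    (auto intro!: continuous_intros derivative_eq_intros simp: power2_eq_square)

text \<open>Every point of a nondegenerate interval, end points included, is a limit point of it.
  This settles uniqueness for the \<open>THE\<close> in the Dirichlet to Neumann operators, which
  use one-sided derivatives at \<gamma>.\<close>

lemma has_real_derivative_within_Icc_unique:
  fixes f :: "real \<Rightarrow> real"
  assumes "l < r" and "x \<in> {l..r}"
    and "(f has_real_derivative c) (at x within {l..r})"
    and "(f has_real_derivative d) (at x within {l..r})"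
  shows "c = d"
proof -
  have "at x within {l..r} \<noteq> bot"
    using assms(1,2) by (simp add: trivial_limit_within islimpt_Icc)
  then show ?thesis
    by (rule has_field_derivative_unique[OF assms(3,4)])
qed

lemma DtN1_op_eq:
  assumes "a \<noteq> 0" and "0 < \<gamma>"
  shows "DtN1_op a \<gamma> g = a * cosh (a * \<gamma>) / sinh (a * \<gamma>) * g"
  unfolding DtN1_op_def
proof (rule the_equality)
  let ?u = "\<lambda>x. g / sinh (a * \<gamma>) * sinh (a * (x - 0))"
  let ?d = "a * cosh (a * \<gamma>) / sinh (a * \<gamma>) * g"
  have u_deriv: "(?u has_real_derivative ?d) (at \<gamma> within {0..\<gamma>})"
    using has_real_derivative_sinh_affine[of "g / sinh (a * \<gamma>)" a 0 \<gamma>] by (simp add: mult_ac)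
  show "\<exists>u. solves_ode a 0 \<gamma> u \<and> u 0 = 0 \<and> u \<gamma> = g
      \<and> (u has_real_derivative ?d) (at \<gamma> within {0..\<gamma>})"
    using assms u_deriv by (intro exI[of _ ?u] conjI solves_ode_sinh) auto
  fix d
  assume "\<exists>u. solves_ode a 0 \<gamma> u \<and> u 0 = 0 \<and> u \<gamma> = g
      \<and> (u has_real_derivative d) (at \<gamma> within {0..\<gamma>})"
  then obtain u where u: "solves_ode a 0 \<gamma> u" "u 0 = 0" "u \<gamma> = g"
    "(u has_real_derivative d) (at \<gamma> within {0..\<gamma>})" by blast
  have "u x = ?u x" if "x \<in> {0..\<gamma>}" for x
    using solves_ode_boundary_form[OF assms u(1) that] u(2,3) by simp
  \<comment> \<open>The one-sided derivative sees only values in the interval, where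
    \<open>u\<close> and \<open>?u\<close> agree; the radius \<open>1\<close> is arbitrary.\<close>
  then have "(?u has_real_derivative d) (at \<gamma> within {0..\<gamma>})"
    using assms(2) by (intro has_field_derivative_transform_within[OF u(4), of 1]) auto
  then show "d = ?d"
    using has_real_derivative_within_Icc_unique[OF assms(2) _ _ u_deriv] assms(2) by auto
qed

lemma DtN2_op_eq:
  assumes "a \<noteq> 0" and "\<gamma> < 1"
  shows "DtN2_op a \<gamma> g = a * cosh (a * (1 - \<gamma>)) / sinh (a * (1 - \<gamma>)) * g"
  unfolding DtN2_op_def
proof (rule the_equality)
  \<comment> \<open>This is the multiple of \<open>sinh (a * (1 - x))\<close> with value
    \<open>g\<close> at \<gamma>; the sign of the coefficient compensates for the reversed argument
    \<open>x - 1\<close>.\<close>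
  let ?u = "\<lambda>x. - g / sinh (a * (1 - \<gamma>)) * sinh (a * (x - 1))"
  let ?d = "a * cosh (a * (1 - \<gamma>)) / sinh (a * (1 - \<gamma>)) * g"
  have flip: "a * (x - 1) = - (a * (1 - x))" for x
    by (simp add: algebra_simps)
  have u_deriv: "(?u has_real_derivative - ?d) (at \<gamma> within {\<gamma>..1})"
    using has_real_derivative_sinh_affine[of "- g / sinh (a * (1 - \<gamma>))" a 1 \<gamma>]
    by (simp add: flip mult_ac)
  show "\<exists>u. solves_ode a \<gamma> 1 u \<and> u 1 = 0 \<and> u \<gamma> = g
      \<and> (u has_real_derivative - ?d) (at \<gamma> within {\<gamma>..1})"
    using assms u_deriv by (intro exI[of _ ?u] conjI solves_ode_sinh) (auto simp: flip)
  fix d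
  assume "\<exists>u. solves_ode a \<gamma> 1 u \<and> u 1 = 0 \<and> u \<gamma> = g
      \<and> (u has_real_derivative - d) (at \<gamma> within {\<gamma>..1})"
  then obtain u where u: "solves_ode a \<gamma> 1 u" "u 1 = 0" "u \<gamma> = g"
    "(u has_real_derivative - d) (at \<gamma> within {\<gamma>..1})" by blast
  have "u x = ?u x" if "x \<in> {\<gamma>..1}" for x
    using solves_ode_boundary_form[OF assms u(1) that] u(2,3) by (simp add: flip)
  then have "(?u has_real_derivative - d) (at \<gamma> within {\<gamma>..1})"
    using assms(2) by (intro has_field_derivative_transform_within[OF u(4), of 1]) auto
  then have "- d = - ?d"
    using has_real_derivative_within_Icc_unique[OF assms(2) _ _ u_deriv] assms(2) by auto
  then show "d = ?d"
    by simp
qed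

lemma the_scalar_eq:
  fixes c :: real
  shows "(THE c'. \<forall>g. c * g = c' * g) = c"
  by (rule the_equality) (auto dest: spec[of _ 1])

lemma DtN1_eq:
  assumes "a \<noteq> 0" and "0 < \<gamma>"
  shows "DtN1 a \<gamma> = a * cosh (a * \<gamma>) / sinh (a * \<gamma>)"
  unfolding DtN1_def DtN1_op_eq[OF assms] by (rule the_scalar_eq)

lemma DtN2_eq:
  assumes "a \<noteq> 0" and "\<gamma> < 1"
  shows "DtN2 a \<gamma> = a * cosh (a * (1 - \<gamma>)) / sinh (a * (1 - \<gamma>))"
  unfolding DtN2_def DtN2_op_eq[OF assms] by (rule the_scalar_eq)

lemma Lim_within_isCont:
  fixes f :: "real \<Rightarrow> real"
  assumes "isCont f x" and "at x within S \<noteq> bot"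
  shows "Lim (at x within S) f = f x"
  using assms by (intro tendsto_Lim) (auto simp: continuous_within intro: tendsto_within_subset)

lemma deriv_G1:
  "deriv (G1 a \<gamma> v) = (\<lambda>x. 1 / calderon_D a \<gamma> *
     (a * v $ 1 * cosh (a * (1 - \<gamma>)) + v $ 2 * sinh (a * (1 - \<gamma>))) * (a * cosh (a * x)))"
  unfolding G1_def by (intro ext DERIV_imp_deriv DERIV_cmult) (auto intro!: derivative_eq_intros)

lemma deriv_G2:
  "deriv (G2 a \<gamma> v) = (\<lambda>x. 1 / calderon_D a \<gamma> *
     (a * v $ 1 * cosh (a * \<gamma>) + v $ 2 * sinh (a * \<gamma>)) * (- a * cosh (a * (1 - x))))"
  unfolding G2_def by (intro ext DERIV_imp_deriv DERIV_cmult) (auto intro!: derivative_eq_intros)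

text \<open>The formula for \<open>G1\<close> is smooth on the whole line, so the one-sided limits
  in the trace are plain values at \<gamma>.\<close>

lemma P1_eq: "P1 a \<gamma> v = vector [G1 a \<gamma> v \<gamma>, deriv (G1 a \<gamma> v) \<gamma>]"
proof -
  have "isCont (G1 a \<gamma> v) \<gamma>"
    unfolding G1_def by (intro continuous_intros)
  moreover have "isCont (deriv (G1 a \<gamma> v)) \<gamma>"
    unfolding deriv_G1 by (intro continuous_intros)
  ultimately show ?thesis
    by (simp add: P1_def T1_def Lim_within_isCont)
qed

lemma P2_eq: "P2 a \<gamma> v = vector [G2 a \<gamma> v \<gamma>, - deriv (G2 a \<gamma> v) \<gamma>]"
proof -
  have "isCont (G2 a \<gamma> v) \<gamma>"
    unfolding G2_def by (intro continuous_intros)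
  moreover have "isCont (deriv (G2 a \<gamma> v)) \<gamma>"
    unfolding deriv_G2 by (intro continuous_intros)
  ultimately show ?thesis
    by (simp add: P2_def T2_def Lim_within_isCont)
qed

lemma vector_2_mult:
  fixes v :: "real^2"
  shows "(vector [vector [p, q], vector [r, s]] :: real^2^2) *v v
    = vector [p * v $ 1 + q * v $ 2, r * v $ 1 + s * v $ 2]"
  by (simp add: vec_eq_iff forall_2 matrix_vector_mult_def sum_2)

theorem mainTheorem5:
  fixes a \<gamma> :: real
  assumes "a > 0" and "0 < \<gamma>" and "\<gamma> < 1"
  shows "P1 a \<gamma> = (\<lambda>v.
      (vector
        [vector [inverse (DtN1 a \<gamma> + DtN2 a \<gamma>) * DtN2 a \<gamma>, inverse (DtN1 a \<gamma> + DtN2 a \<gamma>)],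
         vector [inverse (NtD1 a \<gamma> + NtD2 a \<gamma>), inverse (NtD1 a \<gamma> + NtD2 a \<gamma>) * NtD2 a \<gamma>]]
        :: real^2^2) *v v)
    \<and> P2 a \<gamma> = (\<lambda>v.
      (vector
        [vector [inverse (DtN1 a \<gamma> + DtN2 a \<gamma>) * DtN1 a \<gamma>, inverse (DtN1 a \<gamma> + DtN2 a \<gamma>)],
         vector [inverse (NtD1 a \<gamma> + NtD2 a \<gamma>), inverse (NtD1 a \<gamma> + NtD2 a \<gamma>) * NtD1 a \<gamma>]]
        :: real^2^2) *v v)"
proof -
  define S1 C1 S2 C2 where defs: "S1 = sinh (a * \<gamma>)" "C1 = cosh (a * \<gamma>)"
    "S2 = sinh (a * (1 - \<gamma>))" "C2 = cosh (a * (1 - \<gamma>))"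
  have pos: "S1 > 0" "C1 > 0" "S2 > 0" "C2 > 0"
    using assms by (simp_all add: defs)
  \<comment> \<open>The bracket in \<open>calderon_D\<close>, equal to \<open>sinh a\<close> by the
    addition formula; only its positivity matters below. It is also the numerator of the sum of the
    two hyperbolic cotangents.\<close>
  define E where "E = C2 * S1 + S2 * C1"
  have "E > 0"
    using pos by (simp add: E_def add_pos_pos)
  have D: "calderon_D a \<gamma> = a * E"
    by (simp add: calderon_D_def defs E_def)
  have DtN: "DtN1 a \<gamma> = a * C1 / S1" "DtN2 a \<gamma> = a * C2 / S2"
    using assms by (simp_all add: DtN1_eq DtN2_eq defs)
  have "DtN1 a \<gamma> + DtN2 a \<gamma> = a * E / (S1 * S2)"
    using pos by (simp add: DtN E_def field_simps)
  then have sum_DtN: "inverse (DtN1 a \<gamma> + DtN2 a \<gamma>) = S1 * S2 / (a * E)"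
    by simp
  have NtD: "NtD1 a \<gamma> = S1 / (a * C1)" "NtD2 a \<gamma> = S2 / (a * C2)"
    by (simp_all add: NtD1_def NtD2_def DtN)
  have "NtD1 a \<gamma> + NtD2 a \<gamma> = E / (a * C1 * C2)"
    using assms(1) pos by (simp add: NtD E_def field_simps)
  then have sum_NtD: "inverse (NtD1 a \<gamma> + NtD2 a \<gamma>) = a * C1 * C2 / E"
    by simp
  show ?thesis
    \<comment> \<open>Applied to a vector and compared entrywise, both claims become rational
      identities in \<open>S1\<close>, \<open>C1\<close>, \<open>S2\<close>, \<open>C2\<close>,
      \<open>E\<close> and \<open>a\<close>, all of them positive, so denominators can be
      cleared.\<close>
    unfolding fun_eq_iff P1_eq P2_eq vector_2_mult sum_DtN sum_NtD
    unfolding DtN NtD deriv_G1 deriv_G2 G1_def G2_def D defs[symmetric]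
    using assms pos \<open>E > 0\<close>
    by (auto simp: vec_eq_iff forall_2 field_simps)
qed

end
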